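(* Let $c=0$ and let $z_0\in\mathbb{R}$ satisfy $z_0<0$ and $z_0\neq -1$. Then the Exponent Set $E(z_0,0)$ admits no finite universal escape radius. More precisely, for every real $r>0$ there exists an exponent $x\in E(z_0,0)$ such that the orbit generated by $z_{n+1}=z_n^{\,x}$ from $z_0$ satisfies $|z_n|>r$ for some $n\ge 0$, while the orbit remains bounded.
   Context: Complex powers: for $z\in\mathbb{C}\setminus\{0\}$ let $\log z=\ln|z|+i\operatorname{Arg}(z)$ with $\operatorname{Arg}(z)\in(-\pi,\pi]$ (so $\operatorname{Arg}(-a)=\pi$ for $a>0$), and for $x\in\mathbb{C}$ set $z^x=\exp(x\log z)$. For $z=0$: $0^x=0$ if $\operatorname{Re}(x)>0$, and $0^x$ is undefined if $\operatorname{Re}(x)\le 0$. For $(z_0,c,x)\in\mathbb{C}^3$, the orbit $\{z_n\}$ is generated by $z_{n+1}=z_n^{\,x}+c$, continuing as long as the next iterate is defined and terminating otherwise. Exponent Set: for fixed $z_0,c\in\mathbb{C}$, $E(z_0,c)$ is the set of all $x\in\mathbb{C}$ such that $z_n$ is defined for every $n\ge 0$ and $\sup_{n\ge0}|z_n|<\infty$. Universal escape radius: for fixed $z_0,c\in\mathbb{C}$, a finite number $r>0$ is called a universal escape radius for $E(z_0,c)$ if, for every $x\in\mathbb{C}$ for which the orbit is well-defined for all $n\ge 0$, the existence of some $n\ge0$ with $|z_n|>r$ implies $x\notin E(z_0,c)$. *)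

theory Defs
  imports "HOL-Analysis.Analysis"
begin

(* The library's complex powr is exp (x * ln z) for z \<noteq> 0, where ln is the principal branch with
   imaginary part in (-pi, pi], and 0 powr x = 0 for every x. None stands for "undefined", which
   happens exactly for 0 to a power with nonpositive real part. *)
definition cpow :: "complex \<Rightarrow> complex \<Rightarrow> complex option" where
  "cpow z x = (if z = 0 \<and> Re x \<le> 0 then None else Some (z powr x))"

(* None from the step at which the orbit terminates onwards. *)
primrec power_orbit :: "complex \<Rightarrow> complex \<Rightarrow> complex \<Rightarrow> nat \<Rightarrow> complex option" where
  "power_orbit z0 c x 0 = Some z0"
| "power_orbit z0 c x (Suc n) =
     (case power_orbit z0 c x n of
        None \<Rightarrow> None
      | Some z \<Rightarrow> map_option (\<lambda>w. w + c) (cpow z x))"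

definition orbit_defined :: "complex \<Rightarrow> complex \<Rightarrow> complex \<Rightarrow> bool" where
  "orbit_defined z0 c x \<longleftrightarrow> (\<forall>n. power_orbit z0 c x n \<noteq> None)"

definition orbit_bounded :: "complex \<Rightarrow> complex \<Rightarrow> complex \<Rightarrow> bool" where
  "orbit_bounded z0 c x \<longleftrightarrow> bdd_above {cmod z |n z. power_orbit z0 c x n = Some z}"

definition exponent_set :: "complex \<Rightarrow> complex \<Rightarrow> complex set" where
  "exponent_set z0 c = {x. orbit_defined z0 c x \<and> orbit_bounded z0 c x}"

definition orbit_exceeds :: "complex \<Rightarrow> complex \<Rightarrow> complex \<Rightarrow> real \<Rightarrow> bool" where
  "orbit_exceeds z0 c x r \<longleftrightarrow> (\<exists>n z. power_orbit z0 c x n = Some z \<and> cmod z > r)"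

definition universal_escape_radius :: "complex \<Rightarrow> complex \<Rightarrow> real \<Rightarrow> bool" where
  "universal_escape_radius z0 c r \<longleftrightarrow>
     r > 0 \<and>
     (\<forall>x. orbit_defined z0 c x \<longrightarrow> orbit_exceeds z0 c x r \<longrightarrow> x \<notin> exponent_set z0 c)"

end

theory Submission
  imports Defs
begin

text \<open>
  Write \<open>L = ln \<bar>z0\<bar> + \<i>\<pi>\<close> for the principal logarithm of \<open>z0\<close>. For \<open>c = 0\<close> the orbit is visible
  on logarithms: one step multiplies the logarithm by \<open>x\<close> and then moves it by a multiple of
  \<open>2\<pi>\<i>\<close> back into the strip \<open>-\<pi> < Im \<le> \<pi>\<close>. For every natural number \<open>M > 0\<close> there is an exponent
  whose orbit is \<open>z0, z1, 1, 1, \<dots>\<close> with \<open>\<bar>z1\<bar> \<ge> exp (2\<pi>M)\<close>; such an orbit is bounded, yet it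
  leaves any prescribed disc.

  Let \<open>k\<close> be the number of turns removed at the first step, so that \<open>Ln z1 = x L + 2\<pi>\<i>k\<close>. With
  \<open>x L = s - \<pi>\<i>k\<close> and \<open>Ln z1 = s + \<pi>\<i>k\<close> the logarithm of the second iterate is, before
  reduction, \<open>x Ln z1 = (s\<^sup>2 + \<pi>\<^sup>2k\<^sup>2) / L\<close>. It equals \<open>-4\<pi>\<i>M\<^sup>2\<close>, which makes that iterate \<open>1\<close>, exactly
  when \<open>s\<^sup>2 = -4\<pi>\<i>M\<^sup>2L - \<pi>\<^sup>2k\<^sup>2\<close>. So \<open>s\<close> is a square root, and the only remaining constraint is that
  \<open>s + \<pi>\<i>k\<close> lies in the strip (lemma \<open>square_root_in_strip\<close>).

  If \<open>k\<close> were allowed to be the real number \<open>M ln \<bar>z0\<bar> / \<pi>\<close>, then \<open>s = 2\<pi>M - \<i>M ln \<bar>z0\<bar>\<close> would be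
  a solution with \<open>s + \<pi>\<i>k\<close> real. Rounding this value of \<open>k\<close> towards zero leaves \<open>Im (s\<^sup>2)\<close>
  unchanged and can only increase \<open>Re (s\<^sup>2)\<close>. Hence \<open>Re s\<close> can only grow and \<open>\<bar>Im s\<bar>\<close> can only
  shrink (lemma \<open>hyperbola_comparison\<close>), and \<open>\<bar>Im s\<bar>\<close> stays between \<open>\<pi>\<bar>k\<bar>\<close> and \<open>\<pi>(\<bar>k\<bar> + 1)\<close>.
  As the signs of \<open>Im s\<close> and \<open>k\<close> are opposite, \<open>s + \<pi>\<i>k\<close> has imaginary part less than \<open>\<pi>\<close> in
  absolute value.
\<close>

text \<open>
  The branch of a hyperbola \<open>p q = const\<close> is traversed monotonically by \<open>p\<^sup>2 - q\<^sup>2\<close>: along it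
  \<open>p\<^sup>2\<close> increases and \<open>q\<^sup>2\<close> decreases. In terms of \<open>s = p + \<i>q\<close>, increasing the real part of \<open>s\<^sup>2\<close>
  with the imaginary part fixed moves \<open>s\<close> away from the imaginary axis and towards the real one.
\<close>
lemma hyperbola_comparison:
  fixes p q p0 q0 :: real
  assumes pq: "p * q = p0 * q0" and le: "p0\<^sup>2 - q0\<^sup>2 \<le> p\<^sup>2 - q\<^sup>2" and "p0 \<noteq> 0"
  shows "p0\<^sup>2 \<le> p\<^sup>2" and "q\<^sup>2 \<le> q0\<^sup>2"
proof -
  have prod: "p\<^sup>2 * q\<^sup>2 = p0\<^sup>2 * q0\<^sup>2"
    using pq by (metis power_mult_distrib)
  have pos: "p0\<^sup>2 > 0"
    using \<open>p0 \<noteq> 0\<close> by simp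
  show p: "p0\<^sup>2 \<le> p\<^sup>2"
  proof (rule ccontr)
    assume "\<not> p0\<^sup>2 \<le> p\<^sup>2"
    then have "p\<^sup>2 * q\<^sup>2 \<le> p0\<^sup>2 * q\<^sup>2" and "q\<^sup>2 < q0\<^sup>2"
      using le by (auto intro!: mult_right_mono)
    moreover from \<open>q\<^sup>2 < q0\<^sup>2\<close> have "p0\<^sup>2 * q\<^sup>2 < p0\<^sup>2 * q0\<^sup>2"
      using pos by simp
    ultimately show False
      using prod by linarith
  qed
  have "p0\<^sup>2 * q\<^sup>2 \<le> p0\<^sup>2 * q0\<^sup>2"
    using mult_right_mono[OF p, of "q\<^sup>2"] prod by simp
  then show "q\<^sup>2 \<le> q0\<^sup>2"
    using pos by simp
qed

lemma exists_round_towards_zero: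
  fixes t :: real
  obtains k :: int where "\<bar>real_of_int k\<bar> \<le> \<bar>t\<bar>" "\<bar>t\<bar> < \<bar>real_of_int k\<bar> + 1" "0 \<le> real_of_int k * t"
proof (cases "t \<ge> 0")
  case True
  then show ?thesis
    using that[of "\<lfloor>t\<rfloor>"] floor_correct[of t] by simp
next
  case False
  then have "real_of_int \<lceil>t\<rceil> \<le> 0"
    by simp
  with False show ?thesis
    using that[of "\<lceil>t\<rceil>"] ceiling_correct[of t] mult_nonpos_nonpos[of "real_of_int \<lceil>t\<rceil>" t]
    by linarith
qed

text \<open>
  The right-hand side of the equation for \<open>s\<^sup>2\<close> is \<open>-4\<pi>\<i>M\<^sup>2(l + \<i>\<pi>) - \<pi>\<^sup>2k\<^sup>2\<close>. The comparison point
  is \<open>2\<pi>M - \<i>Ml\<close>, whose square is this number with \<open>k\<close> replaced by the unrounded \<open>Ml/\<pi>\<close>.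
\<close>
lemma square_root_in_strip:
  fixes M l :: real
  assumes "M > 0"
  obtains s :: complex and k :: int
  where "s\<^sup>2 + (pi * k)\<^sup>2 = - 4 * pi * \<i> * M\<^sup>2 * Complex l pi"
    and "Re s \<ge> 2 * pi * M" and "\<bar>Im s + pi * k\<bar> < pi"
proof -
  obtain k :: int where k: "\<bar>real_of_int k\<bar> \<le> \<bar>M * l / pi\<bar>" "\<bar>M * l / pi\<bar> < \<bar>real_of_int k\<bar> + 1"
      "0 \<le> real_of_int k * (M * l / pi)"
    by (rule exists_round_towards_zero)
  have k_le: "\<bar>pi * k\<bar> \<le> \<bar>M * l\<bar>" and k_gt: "\<bar>M * l\<bar> < \<bar>pi * k\<bar> + pi"
    using k(1,2) by (simp_all add: abs_mult field_simps)
  have "k * l = (k * (M * l / pi)) * (pi / M)"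
    using \<open>M > 0\<close> by simp
  also have "\<dots> \<ge> 0"
    using \<open>M > 0\<close> by (intro mult_nonneg_nonneg[OF k(3)]) simp
  finally have k_sign: "0 \<le> k * l" .
  define s where "s = csqrt (- 4 * pi * \<i> * M\<^sup>2 * Complex l pi - (pi * k)\<^sup>2)"
  define p q where "p = Re s" and "q = Im s"
  have sq: "s\<^sup>2 + (pi * k)\<^sup>2 = - 4 * pi * \<i> * M\<^sup>2 * Complex l pi"
    by (simp add: s_def)
  have s_eq: "s = Complex p q"
    by (simp add: p_def q_def)
  have re: "p\<^sup>2 - q\<^sup>2 + (pi * k)\<^sup>2 = (2 * pi * M)\<^sup>2"
    using arg_cong[OF sq, of Re] unfolding s_eq
    by (simp add: power2_eq_square algebra_simps)
  have im: "p * q = (2 * pi * M) * (- (M * l))"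
    using arg_cong[OF sq, of Im] unfolding s_eq
    by (simp add: power2_eq_square algebra_simps)
  have "(pi * k)\<^sup>2 \<le> (M * l)\<^sup>2"
    using k_le by (simp add: abs_le_square_iff)
  then have le: "(2 * pi * M)\<^sup>2 - (- (M * l))\<^sup>2 \<le> p\<^sup>2 - q\<^sup>2"
    using re by simp
  have nz: "2 * pi * M \<noteq> 0"
    using \<open>M > 0\<close> by simp
  have p2: "(2 * pi * M)\<^sup>2 \<le> p\<^sup>2" and q2: "q\<^sup>2 \<le> (- (M * l))\<^sup>2"
    using hyperbola_comparison[OF im le nz] by blast+
  have "p \<ge> 0"
    using csqrt_principal[of "- 4 * pi * \<i> * M\<^sup>2 * Complex l pi - (pi * k)\<^sup>2"]
    by (auto simp: p_def s_def)
  with p2 have p: "p \<ge> 2 * pi * M"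
    by (rule power2_le_imp_le)
  have "\<bar>q\<bar> \<le> \<bar>M * l\<bar>"
    using q2 by (simp flip: abs_le_square_iff)
  with k_gt have q_lt: "\<bar>q\<bar> < \<bar>pi * k\<bar> + pi"
    by simp
  have "(pi * k)\<^sup>2 \<le> q\<^sup>2"
    using re p2 by simp
  then have q_ge: "\<bar>pi * k\<bar> \<le> \<bar>q\<bar>"
    by (simp add: abs_le_square_iff)
  have "p > 0"
    using p \<open>M > 0\<close> by (smt (verit) mult_pos_pos pi_gt_zero)
  have "p * (q * (pi * k)) = - (2 * pi\<^sup>2 * M\<^sup>2 * (k * l))"
  proof -
    have "p * (q * (pi * k)) = (p * q) * (pi * k)"
      by simp
    then show ?thesis
      unfolding im by (simp add: power2_eq_square)
  qed
  also have "\<dots> \<le> 0"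
    using k_sign by simp
  finally have "q * (pi * k) \<le> 0"
    using \<open>p > 0\<close> by (simp add: mult_le_0_iff)
  then have "0 \<le> q \<and> pi * k \<le> 0 \<or> q \<le> 0 \<and> 0 \<le> pi * k"
    by (rule mult_le_0_iff[THEN iffD1])
  \<comment> \<open>Opposite signs turn the sum into a difference of absolute values.\<close>
  then have "\<bar>q + pi * k\<bar> = \<bar>q\<bar> - \<bar>pi * k\<bar>"
    using q_ge by linarith
  with q_lt have "\<bar>q + pi * k\<bar> < pi"
    by simp
  with sq p show ?thesis
    using that[of s k] by (simp add: p_def q_def)
qed

text \<open>
  Here \<open>w\<close> is the logarithm of the first iterate, and \<open>x w\<close> is a logarithm of the second one.
\<close>
lemma exponent_with_large_first_iterate:
  fixes z0 :: real and M :: nat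
  assumes "z0 < 0" and "M > 0"
  obtains x w :: complex
  where "complex_of_real z0 powr x = exp w" and "exp w powr x = 1" and "Re w \<ge> 2 * pi * M"
proof -
  define L where "L = Complex (ln \<bar>z0\<bar>) pi"
  have L: "Ln (complex_of_real z0) = L"
    using \<open>z0 < 0\<close> Ln_of_real'[of z0] by (simp add: L_def complex_eq_iff)
  have "L \<noteq> 0"
    by (simp add: L_def complex_eq_iff)
  obtain s :: complex and k :: int
    where sq: "s\<^sup>2 + (pi * k)\<^sup>2 = - 4 * pi * \<i> * (real M)\<^sup>2 * L"
      and re: "Re s \<ge> 2 * pi * M" and im: "\<bar>Im s + pi * k\<bar> < pi"
    unfolding L_def using square_root_in_strip[of "real M" "ln \<bar>z0\<bar>"] \<open>M > 0\<close> by auto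
  define x where "x = (s - \<i> * pi * k) / L"
  define w where "w = s + \<i> * pi * k"
  have "complex_of_real z0 powr x = exp (s - \<i> * pi * k)"
    using \<open>z0 < 0\<close> \<open>L \<noteq> 0\<close> by (simp add: powr_def L x_def)
  also have "\<dots> = exp w"
    unfolding exp_eq w_def by (intro exI[of _ "- k"]) (simp add: algebra_simps)
  finally have first: "complex_of_real z0 powr x = exp w" .
  have "Ln (exp w) = w"
    using im by (intro Ln_exp) (auto simp: w_def)
  moreover have "x * w = - 4 * pi * \<i> * (real M)\<^sup>2"
  proof -
    have "x * w = (s\<^sup>2 + (pi * k)\<^sup>2) / L"
      by (simp add: x_def w_def power2_eq_square algebra_simps)
    then show ?thesis
      using sq \<open>L \<noteq> 0\<close> by simp
  qed
  moreover have "exp (- 4 * pi * \<i> * (real M)\<^sup>2) = 1"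
    unfolding exp_eq_1 by (intro conjI exI[of _ "- 2 * (int M)\<^sup>2"]) simp_all
  ultimately have "exp w powr x = 1"
    by (simp add: powr_def)
  with first re show ?thesis
    using that[of x w] by (simp add: w_def)
qed

lemma power_orbit_reaching_one:
  assumes "z0 \<noteq> 0" and "z0 powr x = exp w" and "exp w powr x = 1"
  shows "power_orbit z0 0 x n = Some (if n = 0 then z0 else if n = 1 then exp w else 1)"
  by (induction n) (use assms in \<open>auto simp: cpow_def\<close>)

lemma bounded_orbit_exceeding:
  fixes z0 r :: real
  assumes "z0 < 0"
  shows "\<exists>x \<in> exponent_set (complex_of_real z0) 0. orbit_exceeds (complex_of_real z0) 0 x r"
proof -
  obtain M :: nat where M: "M > max 0 r"
    using reals_Archimedean2 by blast
  then obtain x w where xw: "complex_of_real z0 powr x = exp w" "exp w powr x = 1"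
      "Re w \<ge> 2 * pi * M"
    using exponent_with_large_first_iterate[OF assms, of M] by auto
  have orbit: "power_orbit (complex_of_real z0) 0 x n =
      Some (if n = 0 then complex_of_real z0 else if n = 1 then exp w else 1)" for n
    using power_orbit_reaching_one[OF _ xw(1,2)] assms by simp
  have "orbit_bounded (complex_of_real z0) 0 x"
    unfolding orbit_bounded_def orbit
    by (rule bdd_above_mono[of "{\<bar>z0\<bar>, exp (Re w), 1}"]) auto
  then have "x \<in> exponent_set (complex_of_real z0) 0"
    by (simp add: exponent_set_def orbit_defined_def orbit)
  moreover have "cmod (exp w) > r"
  proof -
    have "real M \<le> 2 * pi * M"
      using pi_gt3 by (simp add: mult_le_cancel_right1)
    then have "r < 1 + Re w"
      using M xw(3) by linarith
    also have "\<dots> \<le> exp (Re w)"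
      by (rule exp_ge_add_one_self)
    finally show ?thesis
      by simp
  qed
  then have "orbit_exceeds (complex_of_real z0) 0 x r"
    unfolding orbit_exceeds_def
    by (intro exI[of _ "1 :: nat"] exI[of _ "exp w"]) (simp add: orbit del: power_orbit.simps)
  ultimately show ?thesis
    by blast
qed

theorem theorem3p3:
  fixes z0 :: real
  assumes "z0 < 0" and "z0 \<noteq> -1"
  shows "\<not> (\<exists>r. universal_escape_radius (complex_of_real z0) 0 r) \<and>
    (\<forall>r::real. r > 0 \<longrightarrow>
      (\<exists>x \<in> exponent_set (complex_of_real z0) 0.
         orbit_exceeds (complex_of_real z0) 0 x r \<and>
         orbit_bounded (complex_of_real z0) 0 x))"
  using bounded_orbit_exceeding[OF \<open>z0 < 0\<close>]
  unfolding universal_escape_radius_def exponent_set_def by blast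

end
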